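(* Let $K$ be an arbitrary field. Let $\mathcal{ECS}_{\rm I}$ be the family of all endo-commutative algebras $S(p,q,a,b,c,d)$ with $(p,q,a,b,c,d)\in K^6$ such that exactly one of $p,a,c$ is nonzero. Then $$\mathcal{ECS}_{\rm I}=\{S(p,0,0,0,0,0) : p\in K,\ p\neq 0\}.$$
   Context: $K$ is an arbitrary field. An algebra over $K$ is a $K$-vector space with a $K$-bilinear multiplication, not assumed associative, commutative or unital. An algebra $A$ is endo-commutative if $x^2y^2=(xy)^2$ for all $x,y\in A$. For $(p,q,a,b,c,d)\in K^6$, $S(p,q,a,b,c,d)$ denotes the algebra over $K$ with fixed linear base $\{e,f\}$ and multiplication $e^2=f$, $ef=ae+bf$, $fe=ce+df$, $f^2=pe+qf$. Such an algebra is identified with its structure constants with respect to $\{e,f\}$, so $S(p,q,a,b,c,d)=S(p',q',a',b',c',d')$ means $(p,q,a,b,c,d)=(p',q',a',b',c',d')$. *)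

theory Defs
  imports "HOL-Analysis.Cartesian_Space"
begin

text \<open>Algebras over a field: the product is bilinear, and nothing else is assumed of it.\<close>

locale nonassoc_algebra = vector_space scale
  for scale :: "'k::field \<Rightarrow> 'v::ab_group_add \<Rightarrow> 'v" +
  fixes mult :: "'v \<Rightarrow> 'v \<Rightarrow> 'v"
  assumes linear_left: "\<And>y. Vector_Spaces.linear scale scale (\<lambda>x. mult x y)"
    and linear_right: "\<And>x. Vector_Spaces.linear scale scale (\<lambda>y. mult x y)"

definition endo_commutative :: "('v \<Rightarrow> 'v \<Rightarrow> 'v) \<Rightarrow> bool" where
  "endo_commutative m \<longleftrightarrow> (\<forall>x y. m (m x x) (m y y) = m (m x y) (m x y))"

definition base_e :: "'k::field ^ 2" where "base_e = axis 1 1"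
definition base_f :: "'k::field ^ 2" where "base_f = axis 2 1"

text \<open>
  An algebra with fixed linear base \<open>{base_e, base_f}\<close> is represented by its multiplication on the
  coordinate space \<open>'k ^ 2\<close>. The definition is the bilinear extension of the multiplication
  table; \<open>S_eq_iff\<close> shows that equality of multiplications is equality of structure constants.
\<close>

definition S :: "'k::field \<Rightarrow> 'k \<Rightarrow> 'k \<Rightarrow> 'k \<Rightarrow> 'k \<Rightarrow> 'k \<Rightarrow> 'k ^ 2 \<Rightarrow> 'k ^ 2 \<Rightarrow> 'k ^ 2" where
  "S p q a b c d x y =
     (x $ 1 * y $ 1) *s base_f + (x $ 1 * y $ 2) *s (a *s base_e + b *s base_f)
     + (x $ 2 * y $ 1) *s (c *s base_e + d *s base_f) + (x $ 2 * y $ 2) *s (p *s base_e + q *s base_f)"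

lemma nonassoc_algebra_S: "nonassoc_algebra (*s) (S p q a b c d)"
  by unfold_locales (simp_all add: S_def base_e_def base_f_def vec_eq_iff forall_2 axis_def algebra_simps)

lemma S_base:
  "S p q a b c d base_e base_e = base_f"
  "S p q a b c d base_e base_f = a *s base_e + b *s base_f"
  "S p q a b c d base_f base_e = c *s base_e + d *s base_f"
  "S p q a b c d base_f base_f = p *s base_e + q *s base_f"
  by (simp_all add: S_def base_e_def base_f_def vec_eq_iff forall_2 axis_def)

lemma S_unique:
  assumes "nonassoc_algebra (*s) m"
    and "m base_e base_e = base_f" "m base_e base_f = a *s base_e + b *s base_f"
      "m base_f base_e = c *s base_e + d *s base_f" "m base_f base_f = p *s base_e + q *s base_f"
  shows "m = S p q a b c d"
proof (intro ext)
  fix x y :: "'a ^ 2"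
  interpret nonassoc_algebra "(*s)" m by fact
  have ex: "z = z $ 1 *s base_e + z $ 2 *s base_f" for z :: "'a ^ 2"
    by (simp add: base_e_def base_f_def vec_eq_iff forall_2 axis_def)
  have lin: "module_hom (*s) (*s) (\<lambda>x. m x y)" "module_hom (*s) (*s) (\<lambda>y. m x y)" for x y
    using linear_left linear_right by (simp_all add: Vector_Spaces.linear_def)
  note L = module_hom.add[OF lin(1)] module_hom.scale[OF lin(1)]
  note R = module_hom.add[OF lin(2)] module_hom.scale[OF lin(2)]
  have "m x y = m (x $ 1 *s base_e + x $ 2 *s base_f) (y $ 1 *s base_e + y $ 2 *s base_f)"
    using ex by metis
  also have "\<dots> = S p q a b c d x y"
    by (simp only: L R assms(2-)) (simp add: S_def vec_eq_iff algebra_simps)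
  finally show "m x y = S p q a b c d x y" .
qed

lemma S_eq_iff:
  "S p q a b c d = S p' q' a' b' c' d' \<longleftrightarrow> (p, q, a, b, c, d) = (p', q', a', b', c', d')"
proof
  assume eq: "S p q a b c d = S p' q' a' b' c' d'"
  have "S p q a b c d base_e base_f = S p' q' a' b' c' d' base_e base_f"
    "S p q a b c d base_f base_e = S p' q' a' b' c' d' base_f base_e"
    "S p q a b c d base_f base_f = S p' q' a' b' c' d' base_f base_f"
    by (simp_all only: eq)
  then show "(p, q, a, b, c, d) = (p', q', a', b', c', d')"
    unfolding S_base by (simp add: base_e_def base_f_def vec_eq_iff forall_2 axis_def)
qed simp

definition ECS_I :: "('k::field ^ 2 \<Rightarrow> 'k ^ 2 \<Rightarrow> 'k ^ 2) set" where
  "ECS_I = {S p q a b c d | p q a b c d.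
     endo_commutative (S p q a b c d) \<and>
     (p \<noteq> 0 \<and> a = 0 \<and> c = 0 \<or> p = 0 \<and> a \<noteq> 0 \<and> c = 0 \<or> p = 0 \<and> a = 0 \<and> c \<noteq> 0)}"

end

theory Submission
  imports Defs
begin

text \<open>
  For \<open>p \<noteq> 0\<close> and \<open>a = c = 0\<close>, the identity at \<open>(e, f)\<close> gives \<open>q = b^2\<close> and \<open>d = 0\<close>, and then the
  identity at \<open>(f, e)\<close> gives \<open>q = 0\<close>. If only \<open>a\<close> is nonzero, the \<open>e\<close>-coordinates at \<open>(e + f, e)\<close>
  give \<open>a^2 = 0\<close>; if only \<open>c\<close> is nonzero, those at \<open>(e, e + f)\<close> give \<open>c^2 = 0\<close>.
\<close>

lemma S_nth:
  "S p q a b c d x y $ 1 = x $ 1 * y $ 2 * a + x $ 2 * y $ 1 * c + x $ 2 * y $ 2 * p"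
  "S p q a b c d x y $ 2 =
     x $ 1 * y $ 1 + x $ 1 * y $ 2 * b + x $ 2 * y $ 1 * d + x $ 2 * y $ 2 * q"
  by (simp_all add: S_def base_e_def base_f_def axis_def)

lemma base_nth [simp]:
  "base_e $ 1 = 1" "base_e $ 2 = 0" "base_f $ 1 = 0" "base_f $ 2 = 1"
  by (simp_all add: base_e_def base_f_def axis_def)

lemma endo_commutative_S_nth:
  assumes "endo_commutative (S p q a b c d)"
  shows "S p q a b c d (S p q a b c d x x) (S p q a b c d y y) $ i =
    S p q a b c d (S p q a b c d x y) (S p q a b c d x y) $ i"
  using assms unfolding endo_commutative_def by metis

text \<open>The product of \<open>x\<close> and \<open>y\<close> has coordinates
  \<open>p * x $ 2 * y $ 2\<close> and \<open>x $ 1 * y $ 1\<close>, so both sides expand to the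
  same monomials.\<close>

lemma endo_commutative_S_p: "endo_commutative (S p 0 0 0 0 0)"
  by (simp add: endo_commutative_def vec_eq_iff forall_2 S_nth algebra_simps)

lemma endo_commutative_S_only_p:
  assumes ec: "endo_commutative (S p q 0 b 0 d)" and p: "p \<noteq> 0"
  shows "q = 0" "b = 0" "d = 0"
proof -
  note ef = endo_commutative_S_nth[OF ec, where x = base_e and y = base_f]
  note fe = endo_commutative_S_nth[OF ec, where x = base_f and y = base_e]
  have q: "q = b * b" using ef[of 1] p by (simp add: S_nth)
  \<comment> \<open>The \<open>f\<close>-coordinates read \<open>p * d + q^2 = b^2 * q\<close>; the
    last term is \<open>q^2\<close>.\<close>
  have "p * d = 0" using ef[of 2] by (simp add: S_nth q)
  then show d: "d = 0" using p by simp
  \<comment> \<open>The \<open>e\<close>-coordinates read \<open>q * p = d^2 * p\<close>.\<close>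
  show "q = 0" using fe[of 1] p d by (simp add: S_nth)
  then show "b = 0" using q by simp
qed

text \<open>Here \<open>(e + f) e\<close> is a multiple of \<open>f\<close>, hence so is its square,
  whereas \<open>(e + f)^2\<close> has \<open>e\<close>-coordinate \<open>a\<close> and multiplying
  it by \<open>e^2 = f\<close> on the right gives \<open>a^2\<close>.\<close>

lemma endo_commutative_S_only_a:
  assumes "endo_commutative (S 0 q a b 0 d)"
  shows "a = 0"
  using endo_commutative_S_nth[OF assms, where x = "base_e + base_f" and y = base_e and i = 1]
  by (simp add: S_nth)

text \<open>The mirror image of the case of \<open>a\<close>, with the factors of every product
  interchanged.\<close>

lemma endo_commutative_S_only_c:
  assumes "endo_commutative (S 0 q 0 b c d)"
  shows "c = 0"
  using endo_commutative_S_nth[OF assms, where x = base_e and y = "base_e + base_f" and i = 1]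
  by (simp add: S_nth)

theorem proposition3:
  "(ECS_I :: ('k::field ^ 2 \<Rightarrow> 'k ^ 2 \<Rightarrow> 'k ^ 2) set) = {S p 0 0 0 0 0 | p. p \<noteq> 0}"
proof (intro equalityI subsetI)
  fix m :: "'k ^ 2 \<Rightarrow> 'k ^ 2 \<Rightarrow> 'k ^ 2"
  assume "m \<in> ECS_I"
  then obtain p q a b c d where m: "m = S p q a b c d" and ec: "endo_commutative (S p q a b c d)"
    and "p \<noteq> 0 \<and> a = 0 \<and> c = 0 \<or> p = 0 \<and> a \<noteq> 0 \<and> c = 0 \<or> p = 0 \<and> a = 0 \<and> c \<noteq> 0"
    unfolding ECS_I_def by blast
  \<comment> \<open>Both cases with \<open>p = 0\<close> are contradictory.\<close>
  then have "p \<noteq> 0" "a = 0" "c = 0"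
    using endo_commutative_S_only_a[of q a b d] endo_commutative_S_only_c[of q b c d] by auto
  moreover from this have "q = 0" "b = 0" "d = 0"
    using endo_commutative_S_only_p[of p q b d] ec by simp_all
  ultimately show "m \<in> {S p 0 0 0 0 0 | p. p \<noteq> 0}"
    using m by auto
next
  fix m :: "'k ^ 2 \<Rightarrow> 'k ^ 2 \<Rightarrow> 'k ^ 2"
  assume "m \<in> {S p 0 0 0 0 0 | p. p \<noteq> 0}"
  then obtain p where "m = S p 0 0 0 0 0" "p \<noteq> 0"
    by blast
  then show "m \<in> ECS_I"
    unfolding ECS_I_def using endo_commutative_S_p[of p]
    by (intro CollectI exI[of _ p] exI[of _ 0]) simp
qed

end
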